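(* $\mathscr{I}(W_5) \le \frac{1019}{3888}$.
   Context: All graphs are finite and simple. $W_{5}$ denotes the $5$-wheel, the join of the cycle $C_{5}$ with a single vertex $K_1$ (so $W_5$ has $6$ vertices). The Cartesian product $G \Box H$ has vertex set $V(G)\times V(H)$, with $(u,x)$ adjacent to $(v,y)$ if and only if either $u=v$ and $xy\in E(H)$, or $x=y$ and $uv\in E(G)$. Set $G^{\Box 1}=G$ and $G^{\Box k}=G^{\Box (k-1)}\Box G$ for $k\ge 2$. $\alpha(G)$ is the independence number of $G$. The independence ratio is $i(G)=\alpha(G)/|V(G)|$, and the ultimate independence ratio is $\mathscr{I}(G)=\lim_{m\to\infty} i(G^{\Box m})$; this limit exists because $i(G^{\Box (m+1)})\le i(G^{\Box m})$ for all $m$. *)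

theory Defs
  imports Complex_Main "Graph_Theory.Pair_Digraph"
begin

text \<open>
  A simple graph is a loop-free symmetric digraph without parallel arcs, as in
  \<^locale>\<open>pair_graph\<close>: an edge \<open>uv\<close> is the pair of arcs \<open>(u, v)\<close>, \<open>(v, u)\<close>.
\<close>

definition cart_prod ::
    "'a pair_pre_digraph \<Rightarrow> 'b pair_pre_digraph \<Rightarrow> ('a \<times> 'b) pair_pre_digraph"
    (infixl "\<box>" 70) where
  "G \<box> H = \<lparr> pverts = pverts G \<times> pverts H,
     parcs = {((u, x), (v, y)) | u x v y.
       u = v \<and> u \<in> pverts G \<and> (x, y) \<in> parcs H \<or>
       x = y \<and> x \<in> pverts H \<and> (u, v) \<in> parcs G} \<rparr>"

definition rename_verts :: "('a \<Rightarrow> 'b) \<Rightarrow> 'a pair_pre_digraph \<Rightarrow> 'b pair_pre_digraph" where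
  "rename_verts f G = \<lparr> pverts = f ` pverts G, parcs = map_prod f f ` parcs G \<rparr>"

text \<open>
  The nested pairs forming the vertices of the \<open>k\<close>-th power would have a type depending on
  \<open>k\<close>, so they are flattened to lists of length \<open>k\<close> along the injection
  \<open>(xs, x) \<mapsto> xs @ [x]\<close>. The recursion starts at the one-vertex graph, the neutral element of
  the product; \<open>cart_power_1\<close> and \<open>cart_power_Suc\<close> below give the recursion
  that starts at \<open>k = 1\<close>.
\<close>

primrec cart_power :: "'a pair_pre_digraph \<Rightarrow> nat \<Rightarrow> 'a list pair_pre_digraph" where
  "cart_power G 0 = \<lparr> pverts = {[]}, parcs = {} \<rparr>"
| cart_power_Suc:
  "cart_power G (Suc k) = rename_verts (\<lambda>(xs, x). xs @ [x]) (cart_power G k \<box> G)"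

definition graph_join ::
    "'a pair_pre_digraph \<Rightarrow> 'b pair_pre_digraph \<Rightarrow> ('a + 'b) pair_pre_digraph" where
  "graph_join G H = \<lparr> pverts = pverts G <+> pverts H,
     parcs = map_prod Inl Inl ` parcs G \<union> map_prod Inr Inr ` parcs H \<union>
       Inl ` pverts G \<times> Inr ` pverts H \<union> Inr ` pverts H \<times> Inl ` pverts G \<rparr>"

text \<open>Meaningful for \<open>n \<ge> 3\<close>.\<close>
definition cycle_graph :: "nat \<Rightarrow> nat pair_pre_digraph" where
  "cycle_graph n = \<lparr> pverts = {..<n},
     parcs = {(i, j). i < n \<and> j < n \<and> (j = (i + 1) mod n \<or> i = (j + 1) mod n)} \<rparr>"

definition single_vertex :: "unit pair_pre_digraph" where
  "single_vertex = \<lparr> pverts = {()}, parcs = {} \<rparr>"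

definition wheel :: "nat \<Rightarrow> (nat + unit) pair_pre_digraph" where
  "wheel n = graph_join (cycle_graph n) single_vertex"

definition independent_verts :: "'a pair_pre_digraph \<Rightarrow> 'a set \<Rightarrow> bool" where
  "independent_verts G S \<longleftrightarrow> S \<subseteq> pverts G \<and> (\<forall>u\<in>S. \<forall>v\<in>S. (u, v) \<notin> parcs G)"

definition independence_number :: "'a pair_pre_digraph \<Rightarrow> nat" where
  "independence_number G = Max (card ` {S. independent_verts G S})"

definition independence_ratio :: "'a pair_pre_digraph \<Rightarrow> real" where
  "independence_ratio G = real (independence_number G) / real (card (pverts G))"

text \<open>The limit exists for every finite graph: see \<open>convergent_independence_ratio\<close> below.\<close>
definition ultimate_independence_ratio :: "'a pair_pre_digraph \<Rightarrow> real" where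
  "ultimate_independence_ratio G = lim (\<lambda>m. independence_ratio (cart_power G m))"


lemma cart_power_1:
  assumes "pair_wf_digraph G"
  shows "cart_power G 1 = rename_verts (\<lambda>x. [x]) G"
proof -
  interpret pair_wf_digraph G by fact
  have "pverts (cart_power G 1) = pverts (rename_verts (\<lambda>x. [x]) G)"
    by (auto simp: cart_prod_def rename_verts_def image_iff)
  moreover have "parcs (cart_power G 1) = parcs (rename_verts (\<lambda>x. [x]) G)"
  proof -
    have *: "parcs (\<lparr> pverts = {[]}, parcs = {} \<rparr> \<box> G) = map_prod (Pair []) (Pair []) ` parcs G"
      by (auto simp: cart_prod_def)
    show ?thesis by (simp add: rename_verts_def * image_image map_prod_def case_prod_beta)
  qed
  ultimately show ?thesis by simp
qed

lemma pverts_cart_power: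
  "pverts (cart_power G k) = {xs. length xs = k \<and> set xs \<subseteq> pverts G}"
proof (induction k)
  case (Suc k)
  show ?case
  proof (intro equalityI subsetI)
    fix ys assume "ys \<in> pverts (cart_power G (Suc k))"
    then show "ys \<in> {xs. length xs = Suc k \<and> set xs \<subseteq> pverts G}"
      using Suc by (auto simp: rename_verts_def cart_prod_def)
  next
    fix ys assume ys: "ys \<in> {xs. length xs = Suc k \<and> set xs \<subseteq> pverts G}"
    then obtain xs x where "ys = xs @ [x]" by (cases ys rule: rev_cases) auto
    then show "ys \<in> pverts (cart_power G (Suc k))"
      using Suc ys by (auto simp: rename_verts_def cart_prod_def image_iff)
  qed
qed auto

lemma parcs_cart_power_Suc:
  "(xs @ [x], ys @ [y]) \<in> parcs (cart_power G (Suc k)) \<longleftrightarrow>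
     xs = ys \<and> xs \<in> pverts (cart_power G k) \<and> (x, y) \<in> parcs G \<or>
     x = y \<and> x \<in> pverts G \<and> (xs, ys) \<in> parcs (cart_power G k)"
  by (auto simp: rename_verts_def cart_prod_def image_iff)

lemma card_pverts_cart_power:
  "finite (pverts G) \<Longrightarrow> card (pverts (cart_power G k)) = card (pverts G) ^ k"
  using card_lists_length_eq[of "pverts G" k] by (simp add: pverts_cart_power conj_commute)

lemma finite_pverts_cart_power: "finite (pverts G) \<Longrightarrow> finite (pverts (cart_power G k))"
  using finite_lists_length_eq[of "pverts G" k] by (simp add: pverts_cart_power conj_commute)

lemma pair_graph_wheel:
  assumes "n \<ge> 3"
  shows "pair_graph (wheel n)"
proof -
  have fin: "finite (parcs (wheel n))"
  proof (rule finite_subset)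
    show "parcs (wheel n) \<subseteq> (Inl ` {..<n} \<union> {Inr ()}) \<times> (Inl ` {..<n} \<union> {Inr ()})"
      by (auto simp: wheel_def graph_join_def cycle_graph_def single_vertex_def)
  qed auto
  have ne: "i \<noteq> Suc i mod n" for i
  proof
    assume *: "i = Suc i mod n"
    then have "i < n" using assms by (metis mod_less_divisor not_numeral_le_zero not_gr_zero)
    then show False using * assms by (cases "Suc i < n") (auto simp: not_less le_Suc_eq)
  qed
  then show ?thesis
    using fin ne ne[symmetric] by unfold_locales
      (auto simp: wheel_def graph_join_def cycle_graph_def single_vertex_def symmetric_def
        intro!: symI)
qed

lemma card_pverts_wheel: "card (pverts (wheel n)) = n + 1"
  by (simp add: wheel_def graph_join_def cycle_graph_def single_vertex_def card_Plus)

lemma finite_independent_verts: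
  "finite (pverts G) \<Longrightarrow> finite {S. independent_verts G S}"
  by (rule finite_subset[of _ "Pow (pverts G)"]) (auto simp: independent_verts_def)

lemma card_le_independence_number:
  "finite (pverts G) \<Longrightarrow> independent_verts G S \<Longrightarrow> card S \<le> independence_number G"
  unfolding independence_number_def by (auto intro!: Max_ge simp: finite_independent_verts)

lemma independence_number_attained:
  assumes "finite (pverts G)"
  obtains S where "independent_verts G S" "card S = independence_number G"
proof -
  have "independent_verts G {}" by (simp add: independent_verts_def)
  then have "independence_number G \<in> card ` {S. independent_verts G S}"
    unfolding independence_number_def using assms by (intro Max_in) (auto simp: finite_independent_verts)
  then show ?thesis using that by auto
qed

lemma independence_number_cart_power_Suc:
  assumes fin: "finite (pverts G)"
  shows "independence_number (cart_power G (Suc k)) \<le>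
    independence_number (cart_power G k) * card (pverts G)"
proof -
  let ?P = "cart_power G"
  obtain S where S: "independent_verts (?P (Suc k)) S"
      and cS: "card S = independence_number (?P (Suc k))"
    using independence_number_attained finite_pverts_cart_power[OF fin] by blast
  define T where "T x = {xs. xs @ [x] \<in> S}" for x
  have sub: "S \<subseteq> pverts (?P (Suc k))" using S by (simp add: independent_verts_def)
  have ind: "independent_verts (?P k) (T x)" if x: "x \<in> pverts G" for x
    unfolding independent_verts_def
  proof (intro conjI subsetI ballI)
    fix xs assume "xs \<in> T x"
    then show "xs \<in> pverts (?P k)" using sub
      by (force simp: T_def pverts_cart_power simp del: cart_power_Suc)
  next
    fix xs ys assume "xs \<in> T x" "ys \<in> T x"
    then have "(xs @ [x], ys @ [x]) \<notin> parcs (?P (Suc k))"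
      using S unfolding independent_verts_def T_def by blast
    then show "(xs, ys) \<notin> parcs (?P k)" using x by (simp add: parcs_cart_power_Suc del: cart_power_Suc)
  qed
  have eq: "S = (\<Union>x\<in>pverts G. (\<lambda>xs. xs @ [x]) ` T x)"
  proof (intro equalityI subsetI)
    fix ys assume ys: "ys \<in> S"
    then have "length ys = Suc k" "set ys \<subseteq> pverts G" using sub
      by (auto simp: pverts_cart_power simp del: cart_power_Suc)
    moreover from this obtain xs x where "ys = xs @ [x]" by (cases ys rule: rev_cases) auto
    ultimately show "ys \<in> (\<Union>x\<in>pverts G. (\<lambda>xs. xs @ [x]) ` T x)" using ys by (auto simp: T_def)
  qed (auto simp: T_def)
  have "card S \<le> (\<Sum>x\<in>pverts G. card ((\<lambda>xs. xs @ [x]) ` T x))"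
    by (subst eq) (rule card_UN_le[OF fin])
  also have "\<dots> \<le> (\<Sum>x\<in>pverts G. independence_number (?P k))"
  proof (rule sum_mono)
    fix x assume "x \<in> pverts G"
    then have "card (T x) \<le> independence_number (?P k)"
      by (intro card_le_independence_number finite_pverts_cart_power fin ind)
    then show "card ((\<lambda>xs. xs @ [x]) ` T x) \<le> independence_number (?P k)"
      by (simp add: card_image inj_on_def)
  qed
  finally show ?thesis using cS by (simp add: mult.commute)
qed

lemma decseq_independence_ratio:
  assumes fin: "finite (pverts G)"
  shows "decseq (\<lambda>m. independence_ratio (cart_power G m))"
proof (rule decseq_SucI)
  fix k
  let ?n = "card (pverts G)" and ?a = "\<lambda>k. independence_number (cart_power G k)"
  have "real (?a (Suc k)) \<le> real (?a k) * real ?n"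
    using independence_number_cart_power_Suc[OF fin, of k] by (metis of_nat_le_iff of_nat_mult)
  then have "real (?a (Suc k)) / real (?n ^ Suc k) \<le> real (?a k) * real ?n / real (?n ^ Suc k)"
    by (intro divide_right_mono) auto
  also have "\<dots> \<le> real (?a k) / real (?n ^ k)" by (cases "?n = 0") auto
  finally show "independence_ratio (cart_power G (Suc k)) \<le> independence_ratio (cart_power G k)"
    by (simp add: independence_ratio_def card_pverts_cart_power[OF fin] del: cart_power_Suc)
qed

lemma convergent_independence_ratio:
  assumes "finite (pverts G)"
  shows "convergent (\<lambda>m. independence_ratio (cart_power G m))"
proof -
  have "\<exists>L. (\<lambda>m. independence_ratio (cart_power G m)) \<longlonglongrightarrow> L \<and>
      (\<forall>m. L \<le> independence_ratio (cart_power G m))"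
    by (rule decseq_convergent[OF decseq_independence_ratio[OF assms], of 0])
      (auto simp: independence_ratio_def)
  then show ?thesis by (auto simp: convergent_def)
qed

end

theory Submission
  imports Defs
begin

text \<open>
  Suppose that a weight \<open>u\<close> on the vertices of \<open>G^r\<close> gives every independent set weight at most \<open>B\<close>.
  Cut the coordinates of \<open>G^(r k)\<close> into \<open>k\<close> blocks of length \<open>r\<close> and average \<open>u\<close> over the blocks.
  Fixing all coordinates outside one block leaves an independent set of \<open>G^r\<close>, so the sum of the
  average over an independent set of \<open>G^(r k)\<close> is bounded in terms of \<open>B\<close>; by the weak law of large
  numbers the average is almost constant on \<open>G^(r k)\<close>. Letting \<open>k\<close> grow shows that the ultimate
  independence ratio is at most \<open>B\<close> divided by the total weight.

  For the wheel we take \<open>r = 3\<close> and a weight with total \<open>481\<close> for which \<open>B = 126\<close>. An independent set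
  of the cube labels the cells of a 6 by 6 array with independent sets of the wheel, which have at
  most two elements. Count the elements missing from a full label of size 2 along the 10 rows and
  columns of rim vertices, three times in the hub cell of the line. Every line misses at least 3, and
  the weight is \<open>130\<close> minus the sum of the excesses over this minimum, plus 1 if the set contains
  \<open>(Hub, Hub, Hub)\<close>. The excesses add up to at least 4, and to at least 5 if no hub cell of these lines
  is labelled \<open>{Hub}\<close>, as is the case when \<open>(Hub, Hub, Hub)\<close> is in the set. After normalisation by
  automorphisms of the wheel, this is a propositional problem in three cases.
\<close>

section \<open>The wheel and its cube\<close>

datatype vert = V0 | V1 | V2 | V3 | V4 | Hub

lemma all_vert: "(\<forall>v. P v) \<longleftrightarrow> P V0 \<and> P V1 \<and> P V2 \<and> P V3 \<and> P V4 \<and> P Hub"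
  by (metis vert.exhaust)

lemma UNIV_vert: "UNIV = {V0, V1, V2, V3, V4, Hub}"
  using vert.exhaust by blast

instance vert :: finite
  by standard (simp add: UNIV_vert)

definition edges :: "(vert \<times> vert) list" where
  "edges = [(V0,V1), (V1,V2), (V2,V3), (V3,V4), (V4,V0),
     (V0,Hub), (V1,Hub), (V2,Hub), (V3,Hub), (V4,Hub)]"

definition adj :: "vert \<Rightarrow> vert \<Rightarrow> bool" where
  "adj u v \<longleftrightarrow> (u, v) \<in> set edges \<or> (v, u) \<in> set edges"

lemma adj_simps [simp]:
  "adj u Hub \<longleftrightarrow> u \<noteq> Hub" "adj Hub u \<longleftrightarrow> u \<noteq> Hub" "\<not> adj u u"
  "adj V0 v \<longleftrightarrow> v \<in> {V1, V4, Hub}" "adj V1 v \<longleftrightarrow> v \<in> {V0, V2, Hub}"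
  "adj V2 v \<longleftrightarrow> v \<in> {V1, V3, Hub}" "adj V3 v \<longleftrightarrow> v \<in> {V2, V4, Hub}"
  "adj V4 v \<longleftrightarrow> v \<in> {V3, V0, Hub}"
  by (cases u; auto simp: adj_def edges_def)+

abbreviation rim :: "vert set" where "rim \<equiv> {V0, V1, V2, V3, V4}"

lemma in_rim: "v \<in> rim \<longleftrightarrow> v \<noteq> Hub"
  by (cases v) auto

lemma list_all_rewrites: "list_all P [] = True" "list_all P (x # xs) = (P x \<and> list_all P xs)"
  by simp_all

section \<open>Independent labels and the deficits of cells and lines\<close>

definition indep1 :: "(vert \<Rightarrow> bool) \<Rightarrow> bool" where
  "indep1 P \<longleftrightarrow> (\<forall>u v. adj u v \<longrightarrow> \<not> (P u \<and> P v))"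

definition indep3 :: "(vert \<Rightarrow> vert \<Rightarrow> vert \<Rightarrow> bool) \<Rightarrow> bool" where
  "indep3 S \<longleftrightarrow> (\<forall>a b u v. adj u v \<longrightarrow>
     \<not> (S a b u \<and> S a b v) \<and> \<not> (S a u b \<and> S a v b) \<and> \<not> (S u a b \<and> S v a b))"

text \<open>The first two coordinates address a cell, the third runs over its label. By
  \<open>card_cell\<close> the subtraction does not truncate for independent sets.\<close>

definition deficit :: "(vert \<Rightarrow> vert \<Rightarrow> vert \<Rightarrow> bool) \<Rightarrow> vert \<Rightarrow> vert \<Rightarrow> nat" where
  "deficit S a b = 2 - card {c. S a b c}"

text \<open>
  The cells in the hub column count three times and the others once, so that a rim cell, which lies
  on two rim lines, counts twice in the sum over all lines: these are the weights of \<open>weight\<close> below.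
\<close>
definition row_deficit :: "(vert \<Rightarrow> vert \<Rightarrow> vert \<Rightarrow> bool) \<Rightarrow> vert \<Rightarrow> nat" where
  "row_deficit S a = 3 * deficit S a Hub + (\<Sum>b\<in>rim. deficit S a b)"

text \<open>Again nothing is truncated when \<open>indep3 S\<close> holds, by
  \<open>row_deficit_ge\<close>.\<close>

definition excess :: "(vert \<Rightarrow> vert \<Rightarrow> vert \<Rightarrow> bool) \<Rightarrow> vert \<Rightarrow> nat" where
  "excess S a = row_deficit S a - 3"

definition transposed :: "(vert \<Rightarrow> vert \<Rightarrow> vert \<Rightarrow> bool) \<Rightarrow> vert \<Rightarrow> vert \<Rightarrow> vert \<Rightarrow> bool" where
  "transposed S a b = S b a"

lemma card_Collect_vert:
  "card {c. P c} = of_bool (P V0) + of_bool (P V1) + of_bool (P V2) + of_bool (P V3) + of_bool (P V4)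
     + of_bool (P Hub)"
proof -
  have "card {c. P c} = (\<Sum>c\<in>UNIV. of_bool (P c))"
    by (simp add: of_bool_def sum.If_cases)
  then show ?thesis by (simp add: UNIV_vert)
qed

lemma indep1_edges:
  "indep1 P \<longleftrightarrow> list_all (\<lambda>(c,d). \<not> P c \<or> \<not> P d) edges"
  unfolding indep1_def adj_def list_all_iff by fast

text \<open>Two nonadjacent rim vertices dominate the 5-cycle, so a label of size 2 meets any three
  consecutive rim vertices. This clausal form is what the \<open>sat\<close> calls consume.\<close>

lemma card_indep1:
  assumes "indep1 P"
  shows "card {c. P c} \<le> 2"
    and "card {c. P c} = 2 \<Longrightarrow> \<not> P Hub \<and> (P V0 \<or> P V1 \<or> P V2) \<and> (P V1 \<or> P V2 \<or> P V3)
      \<and> (P V2 \<or> P V3 \<or> P V4) \<and> (P V3 \<or> P V4 \<or> P V0) \<and> (P V4 \<or> P V0 \<or> P V1)"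
  using assms unfolding indep1_edges edges_def card_Collect_vert
  by (cases "P V0"; cases "P V1"; cases "P V2"; cases "P V3"; cases "P V4"; cases "P Hub"; simp)+

lemma indep1_cell: "indep3 S \<Longrightarrow> indep1 (S a b)"
  by (auto simp: indep3_def indep1_def)

lemma card_cell: "indep3 S \<Longrightarrow> card {c. S a b c} + deficit S a b = 2"
  using card_indep1(1)[OF indep1_cell] by (simp add: deficit_def)

lemma full_cell:
  assumes "indep3 S" "deficit S a b = 0"
  shows "\<not> S a b Hub" "S a b V0 \<or> S a b V1 \<or> S a b V2" "S a b V1 \<or> S a b V2 \<or> S a b V3"
    "S a b V2 \<or> S a b V3 \<or> S a b V4" "S a b V3 \<or> S a b V4 \<or> S a b V0" "S a b V4 \<or> S a b V0 \<or> S a b V1"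
  using card_indep1(2)[OF indep1_cell[OF assms(1)], of a b] card_cell[OF assms(1), of a b] assms(2)
  by auto

lemma nonempty_cell:
  assumes "indep3 S" "deficit S a b \<le> 1"
  shows "S a b V0 \<or> S a b V1 \<or> S a b V2 \<or> S a b V3 \<or> S a b V4 \<or> S a b Hub"
proof -
  have "{c. S a b c} \<noteq> {}"
    using card_cell[OF assms(1), of a b] assms(2) by (cases "{c. S a b c} = {}") auto
  then have "\<not> (\<forall>c. \<not> S a b c)" by blast
  then show ?thesis unfolding all_vert by blast
qed

lemma full_cell_pair:
  assumes "indep3 S" "deficit S a b = 0"
  obtains u v where "u \<in> rim" "v \<in> rim" "u \<noteq> v" "\<not> adj u v" "S a b u" "S a b v"
proof -
  have "\<not> S a b Hub" and "card {c. S a b c} = 2"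
    using full_cell(1)[OF assms] card_cell[OF assms(1), of a b] assms(2) by auto
  then obtain u v where uv: "{c. S a b c} = {u, v}" "u \<noteq> v"
    by (auto simp: card_2_iff)
  then have "S a b u" "S a b v" by auto
  with that uv \<open>\<not> S a b Hub\<close> indep1_cell[OF assms(1), of a b] show ?thesis
    unfolding in_rim indep1_def by metis
qed

lemma indep3_transp: "indep3 (transposed S) \<longleftrightarrow> indep3 S"
  by (auto simp: indep3_def transposed_def)

lemma transp_transp [simp]: "transposed (transposed S) = S"
  by (simp add: transposed_def fun_eq_iff)

lemma deficit_transp: "deficit (transposed S) a b = deficit S b a"
  by (simp add: deficit_def transposed_def)

text \<open>In row \<open>a\<close> the hub cell and the cells \<open>u\<close> and \<open>v\<close>
  are pairwise adjacent, so their labels are disjoint. Three full labels would need six of the five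
  rim vertices.\<close>

lemma no_adjacent_full:
  assumes S: "indep3 S" and "deficit S a Hub = 0" "adj u v" "u \<in> rim" "v \<in> rim"
    "deficit S a u = 0" "deficit S a v = 0"
  shows False
proof -
  have disj: "\<not> S a Hub c \<or> \<not> S a u c" "\<not> S a Hub c \<or> \<not> S a v c" "\<not> S a u c \<or> \<not> S a v c" for c
    using S assms(3-5) unfolding indep3_def in_rim by (metis adj_simps(2))+
  note e = indep1_cell[OF S, unfolded indep1_edges edges_def list_all_rewrites prod.case simp_thms]
  show False
    using full_cell[OF S assms(2)] full_cell[OF S assms(6)] full_cell[OF S assms(7)]
      disj[of V0] disj[of V1] disj[of V2] disj[of V3] disj[of V4]
      e[of a Hub] e[of a u] e[of a v]
    by sat
qed

lemma row_deficit_eq: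
  "row_deficit S a = 3 * deficit S a Hub + (deficit S a V0 + deficit S a V1 + deficit S a V2
     + deficit S a V3 + deficit S a V4)"
  by (simp add: row_deficit_def)

text \<open>The nonzero terms form a vertex cover of a 5-cycle, hence number at least three. If the
  sum is 3, two zeros remain, and they are nonadjacent.\<close>

lemma cyclic_sum:
  fixes p q r s t :: nat
  assumes "1 \<le> p + q" "1 \<le> q + r" "1 \<le> r + s" "1 \<le> s + t" "1 \<le> t + p"
  shows "p + q + r + s + t \<ge> 3"
    and "p + q + r + s + t = 3 \<Longrightarrow> p = 0 \<and> r = 0 \<or> q = 0 \<and> s = 0 \<or> r = 0 \<and> t = 0 \<or> s = 0 \<and> p = 0 \<or> t = 0 \<and> q = 0"
proof -
  show "p + q + r + s + t \<ge> 3"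
    using assms by (cases p; cases q; cases r; cases s; cases t; simp)
  show "p + q + r + s + t = 3 \<Longrightarrow> p = 0 \<and> r = 0 \<or> q = 0 \<and> s = 0 \<or> r = 0 \<and> t = 0 \<or> s = 0 \<and> p = 0 \<or> t = 0 \<and> q = 0"
    using assms by (cases "p = 0"; cases "q = 0"; cases "r = 0"; cases "s = 0"; cases "t = 0"; simp)
qed

lemma row_deficit_full:
  assumes S: "indep3 S" and "deficit S a Hub = 0"
  shows "row_deficit S a \<ge> 3"
    and "row_deficit S a = 3 \<Longrightarrow>
      \<exists>u\<in>rim. \<exists>v\<in>rim. u \<noteq> v \<and> \<not> adj u v \<and> deficit S a u = 0 \<and> deficit S a v = 0"
proof -
  let ?d = "deficit S a"
  have na: "\<not> (?d u = 0 \<and> ?d v = 0)" if "adj u v" "u \<in> rim" "v \<in> rim" for u v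
    using no_adjacent_full[OF S assms(2)] that by blast
  have n: "1 \<le> ?d V0 + ?d V1" "1 \<le> ?d V1 + ?d V2" "1 \<le> ?d V2 + ?d V3" "1 \<le> ?d V3 + ?d V4"
      "1 \<le> ?d V4 + ?d V0"
    using na[of V0 V1] na[of V1 V2] na[of V2 V3] na[of V3 V4] na[of V4 V0] by (auto simp: Suc_le_eq)
  then show "row_deficit S a \<ge> 3"
    using assms(2) cyclic_sum(1)[OF n] unfolding row_deficit_eq by linarith
  assume "row_deficit S a = 3"
  then have "?d V0 + ?d V1 + ?d V2 + ?d V3 + ?d V4 = 3"
    using assms(2) unfolding row_deficit_eq by simp
  then have "(?d V0 = 0 \<and> ?d V2 = 0) \<or> (?d V1 = 0 \<and> ?d V3 = 0) \<or> (?d V2 = 0 \<and> ?d V4 = 0)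
     \<or> (?d V3 = 0 \<and> ?d V0 = 0) \<or> (?d V4 = 0 \<and> ?d V1 = 0)"
    using cyclic_sum(2)[OF n] by blast
  then show "\<exists>u\<in>rim. \<exists>v\<in>rim. u \<noteq> v \<and> \<not> adj u v \<and> ?d u = 0 \<and> ?d v = 0"
    by (elim disjE) auto
qed

text \<open>A hub cell that is not full already contributes 3 through its multiplicity.\<close>

lemma row_deficit_ge: 
  assumes "indep3 S" 
  shows "row_deficit S a \<ge> 3"
  using row_deficit_full(1)[OF assms, of a] by (cases "deficit S a Hub") (auto simp: row_deficit_eq)

text \<open>Otherwise the hub label is a single rim vertex \<open>c\<close> and all rim cells are
  full. Their labels avoid \<open>c\<close>, so they are nonadjacent pairs on a path with four
  vertices. There are three such pairs, just two of which are disjoint from one another, so the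
  labels would properly 2-colour a 5-cycle.\<close>

lemma tight_row:
  assumes S: "indep3 S" and "excess S a = 0" "\<not> S a Hub Hub"
  shows "deficit S a Hub = 0"
proof (rule ccontr)
  let ?d = "deficit S a"
  assume h: "?d Hub \<noteq> 0"
  have "row_deficit S a \<le> 3" using assms(2) by (simp add: excess_def)
  with h have d: "?d Hub \<le> 1" "?d V0 = 0" "?d V1 = 0" "?d V2 = 0" "?d V3 = 0" "?d V4 = 0"
    unfolding row_deficit_eq by auto
  have disj: "list_all (\<lambda>(u,v). \<not> S a u c \<or> \<not> S a v c) edges" for c
    using S unfolding indep3_def adj_def list_all_iff by fast
  note ground = disj[unfolded edges_def list_all_rewrites prod.case simp_thms]
    indep1_cell[OF S, unfolded indep1_edges edges_def list_all_rewrites prod.case simp_thms]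
  show False
    using full_cell[OF S d(2)] full_cell[OF S d(3)] full_cell[OF S d(4)] full_cell[OF S d(5)] full_cell[OF S d(6)]
      nonempty_cell[OF S d(1)] assms(3)
      ground(1)[of V0] ground(1)[of V1] ground(1)[of V2] ground(1)[of V3] ground(1)[of V4]
      ground(2)[of a V0] ground(2)[of a V1] ground(2)[of a V2] ground(2)[of a V3] ground(2)[of a V4] 
    by sat
qed

section \<open>The propositional core\<close>

text \<open>Running sums in the order \<open>Hub\<close>, \<open>V0\<close>, ..., \<open>V4\<close>.
  The start value is the tripled hub deficit on a line and 0 when excesses are accumulated.
  Thresholds on these sums encode counting in unary.\<close>

fun partial :: "nat \<Rightarrow> (vert \<Rightarrow> nat) \<Rightarrow> vert \<Rightarrow> nat" where
  "partial z f Hub = z"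
| "partial z f V0 = z + f V0"
| "partial z f V1 = z + f V0 + f V1"
| "partial z f V2 = z + f V0 + f V1 + f V2"
| "partial z f V3 = z + f V0 + f V1 + f V2 + f V3"
| "partial z f V4 = z + f V0 + f V1 + f V2 + f V3 + f V4"

definition steps :: "(vert \<times> vert) list" where
  "steps = [(Hub,V0), (V0,V1), (V1,V2), (V2,V3), (V3,V4)]"

lemma partial_step: "(b, c) \<in> set steps \<Longrightarrow> partial z f c = partial z f b + f c"
  by (auto simp: steps_def)

text \<open>
  Intended meaning: \<open>F a b\<close> and \<open>E a b\<close> say that the cell \<open>(a, b)\<close> has deficit 0 and at most 1;
  \<open>R a b m\<close> (\<open>C a b m\<close>) says that the deficits in row (column) \<open>a\<close>, from the hub up to the cell \<open>b\<close>,
  add up to at least \<open>m\<close>; \<open>X a m\<close> (\<open>Y a m\<close>) says that the excesses of the rows (columns) up to \<open>a\<close>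
  add up to at least \<open>m\<close>. Only the implications needed for a refutation are listed.
\<close>
locale wheel_clauses =
  fixes S :: "vert \<Rightarrow> vert \<Rightarrow> vert \<Rightarrow> bool" and F E :: "vert \<Rightarrow> vert \<Rightarrow> bool"
    and R C :: "vert \<Rightarrow> vert \<Rightarrow> nat \<Rightarrow> bool" and X Y :: "vert \<Rightarrow> nat \<Rightarrow> bool"
  assumes indep: "\<forall>a b. list_all (\<lambda>(u,v). (\<not> S a b u \<or> \<not> S a b v) \<and> (\<not> S a u b \<or> \<not> S a v b)
      \<and> (\<not> S u a b \<or> \<not> S v a b)) edges"
    and full: "\<forall>a b. (\<not> F a b \<or> E a b) \<and> (\<not> F a b \<or> \<not> S a b Hub)
      \<and> list_all (\<lambda>(u,v,w). \<not> F a b \<or> S a b u \<or> S a b v \<or> S a b w)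
           [(V0,V1,V2), (V1,V2,V3), (V2,V3,V4), (V3,V4,V0), (V4,V0,V1)]"
    and nonempty: "\<forall>a b. \<not> E a b \<or> S a b V0 \<or> S a b V1 \<or> S a b V2 \<or> S a b V3 \<or> S a b V4 \<or> S a b Hub"
    and hub: "list_all (\<lambda>a. R a Hub 0 \<and> C a Hub 0
      \<and> list_all (\<lambda>m. (F a Hub \<or> R a Hub m) \<and> (F Hub a \<or> C a Hub m)) [1,2,3]
      \<and> list_all (\<lambda>m. (E a Hub \<or> R a Hub m) \<and> (E Hub a \<or> C a Hub m)) [4,5,6]) [V0,V1,V2,V3,V4]"
    and lines: "list_all (\<lambda>a. list_all (\<lambda>(b,c).
        list_all (\<lambda>m. (\<not> R a b m \<or> R a c m) \<and> (\<not> C a b m \<or> C a c m)) [0,1,2,3,4,5,6,7,8]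
      \<and> list_all (\<lambda>m. (\<not> R a b m \<or> F a c \<or> R a c (m+1)) \<and> (\<not> C a b m \<or> F c a \<or> C a c (m+1)))
           [0,1,2,3,4,5,6,7]
      \<and> list_all (\<lambda>m. (\<not> R a b m \<or> E a c \<or> R a c (m+2)) \<and> (\<not> C a b m \<or> E c a \<or> C a c (m+2)))
           [0,1,2,3,4,5,6]) steps) [V0,V1,V2,V3,V4]"
    and totals: "X Hub 0 \<and> Y Hub 0 \<and> list_all (\<lambda>(a,b).
        list_all (\<lambda>m. (\<not> X a m \<or> X b m) \<and> (\<not> Y a m \<or> Y b m)) [0,1,2,3,4,5]
      \<and> list_all (\<lambda>(m,k). (\<not> X a m \<or> \<not> R b V4 (3+k) \<or> X b (m+k))
          \<and> (\<not> Y a m \<or> \<not> C b V4 (3+k) \<or> Y b (m+k)))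
        [(0,1),(0,2),(0,3),(0,4),(0,5),(1,1),(1,2),(1,3),(1,4),(2,1),(2,2),(2,3),(3,1),(3,2),(4,1)]) steps"
begin

lemmas clauses = indep full nonempty hub lines totals

text \<open>\<open>sat\<close> matches atoms syntactically, so quantifiers and lists are expanded
  and sums such as \<open>3+k\<close> evaluated. The line counters end at 8 = 3 + 5 because the
  budgets below mention no excess above 5.\<close>

lemmas ground = clauses[unfolded all_vert edges_def steps_def list_all_rewrites prod.case simp_thms conj_assoc
  add_0 one_add_one numeral_plus_one numeral_plus_numeral add_num_simps one_plus_numeral]

text \<open>Row \<open>V0\<close> is tight and in normal form. The last assumption states in
  thresholds that the row excesses add up to at most 2 and all excesses to at most 4.\<close>

lemma no_transversal_line:
  assumes "\<not> S V0 Hub Hub \<and> \<not> S V1 Hub Hub \<and> \<not> S V2 Hub Hub \<and> \<not> S V3 Hub Hub \<and> \<not> S V4 Hub Hub"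
    "\<not> S Hub V0 Hub \<and> \<not> S Hub V1 Hub \<and> \<not> S Hub V2 Hub \<and> \<not> S Hub V3 Hub \<and> \<not> S Hub V4 Hub"
    "F V0 Hub" "F V0 V0" "F V0 V2" "S V0 Hub V0" "S V0 Hub V2" "\<not> R V0 V4 4"
    "\<not> X V4 3 \<and> \<not> Y V4 5 \<and> (\<not> X V4 1 \<or> \<not> Y V4 4) \<and> (\<not> X V4 2 \<or> \<not> Y V4 3)"
  shows False
  using assms ground by sat

text \<open>The tight row \<open>V0\<close> is next to a row with \<open>Hub\<close> in its hub
  cell. The last assumption is the threshold form of a total of at most 3, see
  \<open>budget_3\<close>.\<close>

lemma tight_neighbour:
  assumes "S V1 Hub Hub" "F V0 Hub" "F V0 V0" "F V0 V2" "S V0 Hub V0" "S V0 Hub V2" "\<not> R V0 V4 4"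
    "\<not> X V4 4 \<and> \<not> Y V4 4 \<and> (\<not> X V4 1 \<or> \<not> Y V4 3) \<and> (\<not> X V4 2 \<or> \<not> Y V4 2) \<and> (\<not> X V4 3 \<or> \<not> Y V4 1)"
  shows False
  using assms ground by sat

text \<open>Row \<open>V0\<close> has \<open>Hub\<close> in its hub cell, and the threshold 4 gives
  both neighbouring rows positive excess.\<close>

lemma loose_neighbours:
  assumes "S V0 Hub Hub" "F V0 V0" "S V0 V0 V0" "S V0 V0 V2" "R V1 V4 4" "R V4 V4 4"
    "\<not> X V4 4 \<and> \<not> Y V4 4 \<and> (\<not> X V4 1 \<or> \<not> Y V4 3) \<and> (\<not> X V4 2 \<or> \<not> Y V4 2) \<and> (\<not> X V4 3 \<or> \<not> Y V4 1)"
  shows False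
  using assms ground by sat

end

lemma list_allI: "(\<And>x. P x) \<Longrightarrow> list_all P xs"
  by (simp add: list_all_iff)

lemma list_all_pairI: "(\<And>x y. (x, y) \<in> set xs \<Longrightarrow> P x y) \<Longrightarrow> list_all (\<lambda>(x, y). P x y) xs"
  by (auto simp: list_all_iff)

lemma wheel_clauses_of_indep3:
  assumes S: "indep3 S"
  shows "wheel_clauses S (\<lambda>a b. deficit S a b = 0) (\<lambda>a b. deficit S a b \<le> 1)
    (\<lambda>a b m. m \<le> partial (3 * deficit S a Hub) (deficit S a) b)
    (\<lambda>a b m. m \<le> partial (3 * deficit S Hub a) (\<lambda>c. deficit S c a) b)
    (\<lambda>a m. m \<le> partial 0 (excess S) a) (\<lambda>a m. m \<le> partial 0 (excess (transposed S)) a)"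
proof
  show "\<forall>a b. list_all (\<lambda>(u,v). (\<not> S a b u \<or> \<not> S a b v) \<and> (\<not> S a u b \<or> \<not> S a v b)
      \<and> (\<not> S u a b \<or> \<not> S v a b)) edges"
    using S unfolding indep3_def adj_def list_all_iff by fast
  show "\<forall>a b. (\<not> deficit S a b = 0 \<or> deficit S a b \<le> 1) \<and> (\<not> deficit S a b = 0 \<or> \<not> S a b Hub)
      \<and> list_all (\<lambda>(u,v,w). \<not> deficit S a b = 0 \<or> S a b u \<or> S a b v \<or> S a b w)
           [(V0,V1,V2), (V1,V2,V3), (V2,V3,V4), (V3,V4,V0), (V4,V0,V1)]"
  proof (intro allI)
    fix a b
    show "(\<not> deficit S a b = 0 \<or> deficit S a b \<le> 1) \<and> (\<not> deficit S a b = 0 \<or> \<not> S a b Hub)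
      \<and> list_all (\<lambda>(u,v,w). \<not> deficit S a b = 0 \<or> S a b u \<or> S a b v \<or> S a b w)
           [(V0,V1,V2), (V1,V2,V3), (V2,V3,V4), (V3,V4,V0), (V4,V0,V1)]"
      using full_cell[OF S, of a b] by (cases "deficit S a b = 0") simp_all
  qed
  show "\<forall>a b. \<not> deficit S a b \<le> 1 \<or> S a b V0 \<or> S a b V1 \<or> S a b V2 \<or> S a b V3 \<or> S a b V4 \<or> S a b Hub"
    using nonempty_cell[OF S] by blast
next
  \<comment> \<open>The last running sum of a line is its deficit, so the threshold
    \<open>3 + k\<close> on it means an excess of at least \<open>k\<close>.\<close>
  have "row_deficit S b = partial (3 * deficit S b Hub) (deficit S b) V4"
    "row_deficit (transposed S) b = partial (3 * deficit S Hub b) (\<lambda>c. deficit S c b) V4" for b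
    by (simp_all add: row_deficit_eq deficit_transp)
  then have e: "excess S b = partial (3 * deficit S b Hub) (deficit S b) V4 - 3"
    "excess (transposed S) b = partial (3 * deficit S Hub b) (\<lambda>c. deficit S c b) V4 - 3" for b
    by (simp_all add: excess_def)
  show "0 \<le> partial 0 (excess S) Hub \<and> 0 \<le> partial 0 (excess (transposed S)) Hub \<and> list_all (\<lambda>(a,b).
        list_all (\<lambda>m. (\<not> m \<le> partial 0 (excess S) a \<or> m \<le> partial 0 (excess S) b)
          \<and> (\<not> m \<le> partial 0 (excess (transposed S)) a \<or> m \<le> partial 0 (excess (transposed S)) b)) [0,1,2,3,4,5]
      \<and> list_all (\<lambda>(m,k). (\<not> m \<le> partial 0 (excess S) a
          \<or> \<not> 3 + k \<le> partial (3 * deficit S b Hub) (deficit S b) V4 \<or> m + k \<le> partial 0 (excess S) b)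
          \<and> (\<not> m \<le> partial 0 (excess (transposed S)) a
          \<or> \<not> 3 + k \<le> partial (3 * deficit S Hub b) (\<lambda>c. deficit S c b) V4
          \<or> m + k \<le> partial 0 (excess (transposed S)) b))
        [(0,1),(0,2),(0,3),(0,4),(0,5),(1,1),(1,2),(1,3),(1,4),(2,1),(2,2),(2,3),(3,1),(3,2),(4,1)]) steps"
  proof (intro conjI list_all_pairI)
    fix a b assume "(a, b) \<in> set steps"
    note step = partial_step[OF this, of 0 "excess S"] partial_step[OF this, of 0 "excess (transposed S)"]
    show "list_all (\<lambda>m. (\<not> m \<le> partial 0 (excess S) a \<or> m \<le> partial 0 (excess S) b)
          \<and> (\<not> m \<le> partial 0 (excess (transposed S)) a \<or> m \<le> partial 0 (excess (transposed S)) b)) [0,1,2,3,4,5]"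
      by (rule list_allI) (simp only: step, linarith)
    fix m k
    show "\<not> m \<le> partial 0 (excess S) a
          \<or> \<not> 3 + k \<le> partial (3 * deficit S b Hub) (deficit S b) V4 \<or> m + k \<le> partial 0 (excess S) b"
      "\<not> m \<le> partial 0 (excess (transposed S)) a
          \<or> \<not> 3 + k \<le> partial (3 * deficit S Hub b) (\<lambda>c. deficit S c b) V4
          \<or> m + k \<le> partial 0 (excess (transposed S)) b"
      unfolding step e by linarith+
  qed simp_all
next
  let ?R = "\<lambda>a. partial (3 * deficit S a Hub) (deficit S a)"
    and ?C = "\<lambda>a. partial (3 * deficit S Hub a) (\<lambda>c. deficit S c a)"
  show "list_all (\<lambda>a. list_all (\<lambda>(b,c).
        list_all (\<lambda>m. (\<not> m \<le> ?R a b \<or> m \<le> ?R a c) \<and> (\<not> m \<le> ?C a b \<or> m \<le> ?C a c)) [0,1,2,3,4,5,6,7,8]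
      \<and> list_all (\<lambda>m. (\<not> m \<le> ?R a b \<or> deficit S a c = 0 \<or> m + 1 \<le> ?R a c)
         \<and> (\<not> m \<le> ?C a b \<or> deficit S c a = 0 \<or> m + 1 \<le> ?C a c)) [0,1,2,3,4,5,6,7]
      \<and> list_all (\<lambda>m. (\<not> m \<le> ?R a b \<or> deficit S a c \<le> 1 \<or> m + 2 \<le> ?R a c)
         \<and> (\<not> m \<le> ?C a b \<or> deficit S c a \<le> 1 \<or> m + 2 \<le> ?C a c)) [0,1,2,3,4,5,6]) steps) [V0,V1,V2,V3,V4]"
  proof (rule list_allI, rule list_all_pairI, intro conjI list_allI)
    fix a b c :: vert and m assume "(b, c) \<in> set steps"
    note step = partial_step[OF this, of "3 * deficit S a Hub" "deficit S a"]
      partial_step[OF this, of "3 * deficit S Hub a" "\<lambda>c. deficit S c a"]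
    show "\<not> m \<le> ?R a b \<or> m \<le> ?R a c" "\<not> m \<le> ?C a b \<or> m \<le> ?C a c"
      "\<not> m \<le> ?R a b \<or> deficit S a c = 0 \<or> m + 1 \<le> ?R a c"
      "\<not> m \<le> ?C a b \<or> deficit S c a = 0 \<or> m + 1 \<le> ?C a c"
      "\<not> m \<le> ?R a b \<or> deficit S a c \<le> 1 \<or> m + 2 \<le> ?R a c"
      "\<not> m \<le> ?C a b \<or> deficit S c a \<le> 1 \<or> m + 2 \<le> ?C a c"
      unfolding step by linarith+
  qed
\<comment> \<open>The hub clauses remain: by the factor 3, a deficit of 1 reaches the thresholds 1
  to 3 and a deficit of 2 those up to 6.\<close>
qed (auto simp: not_le)

section \<open>Normalisation by automorphisms\<close>

definition automorphism :: "(vert \<Rightarrow> vert) \<Rightarrow> bool" where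
  "automorphism f \<longleftrightarrow> bij f \<and> f Hub = Hub \<and> (\<forall>u v. adj (f u) (f v) \<longleftrightarrow> adj u v)"

fun rot :: "vert \<Rightarrow> vert" where
  "rot V0 = V1" | "rot V1 = V2" | "rot V2 = V3" | "rot V3 = V4" | "rot V4 = V0" | "rot Hub = Hub"

fun reflect :: "vert \<Rightarrow> vert" where
  "reflect V0 = V0" | "reflect V1 = V4" | "reflect V2 = V3" | "reflect V3 = V2" | "reflect V4 = V1" | "reflect Hub = Hub"

lemma autoI:
  assumes "f Hub = Hub" "\<And>u v. adj (f u) (f v) \<longleftrightarrow> adj u v" "\<And>u v. f u = f v \<Longrightarrow> u = v"
  shows "automorphism f"
  using assms finite_UNIV_inj_surj[of f] by (auto simp: automorphism_def bij_def inj_def)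

lemma auto_rot: "automorphism rot"
proof (rule autoI)
  show "adj (rot u) (rot v) \<longleftrightarrow> adj u v" for u v by (cases u; cases v; simp)
  show "rot u = rot v \<Longrightarrow> u = v" for u v by (cases u; cases v; simp)
qed simp

lemma auto_refl: "automorphism reflect"
proof (rule autoI)
  show "adj (reflect u) (reflect v) \<longleftrightarrow> adj u v" for u v by (cases u; cases v; simp)
  show "reflect u = reflect v \<Longrightarrow> u = v" for u v by (cases u; cases v; simp)
qed simp

lemma auto_comp: "automorphism f \<Longrightarrow> automorphism g \<Longrightarrow> automorphism (f \<circ> g)"
  by (auto simp: automorphism_def intro: bij_comp)

lemma auto_rot_power: "automorphism (rot ^^ k)"
proof (induction k)
  case 0 show ?case by (rule autoI) auto
next
  case (Suc k) then show ?case using auto_comp[OF auto_rot] by (simp only: funpow.simps)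
qed

lemma auto_vertex:
  assumes "u \<in> rim"
  obtains f where "automorphism f" "f V0 = u"
proof -
  have "\<exists>k\<in>{0,1,2,3,4}. (rot ^^ k) V0 = u"
    using assms by (auto simp: numeral_eq_Suc)
  then show ?thesis using that auto_rot_power by blast
qed

text \<open>The rotations permute the five nonadjacent rim pairs transitively, as unordered
  pairs.\<close>

lemma auto_nonadjacent:
  assumes "u \<in> rim" "v \<in> rim" "u \<noteq> v" "\<not> adj u v"
  obtains f where "automorphism f" "{f V0, f V2} = {u, v}"
proof -
  have "\<exists>k\<in>{0,1,2,3,4}. {(rot ^^ k) V0, (rot ^^ k) V2} = {u, v}"
    using assms by (cases u; cases v; simp add: numeral_eq_Suc insert_commute)
  then show ?thesis using that auto_rot_power by blast
qed

lemma auto_adjacent: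
  assumes "u \<in> rim" "v \<in> rim" "adj u v"
  obtains f where "automorphism f" "f V0 = u" "f V1 = v"
proof -
  have "\<exists>k\<in>{0,1,2,3,4}. (rot ^^ k) V0 = u \<and> ((rot ^^ k) V1 = v \<or> (rot ^^ k) V4 = v)"
    using assms by (cases u; cases v; simp add: numeral_eq_Suc)
  then obtain k where k: "(rot ^^ k) V0 = u" "(rot ^^ k) V1 = v \<or> (rot ^^ k) V4 = v" by blast
  \<comment> \<open>If the rotation sends \<open>V4\<close> to \<open>v\<close>, it is preceded by
    \<open>reflect\<close>, which fixes \<open>V0\<close> and swaps \<open>V1\<close> with
    \<open>V4\<close>.\<close>
  then show ?thesis
    using that[of "rot ^^ k"] that[of "(rot ^^ k) \<circ> reflect"] auto_rot_power auto_refl auto_comp by auto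
qed

lemma auto_rim: "automorphism f \<Longrightarrow> u \<in> rim \<Longrightarrow> f u \<in> rim"
  unfolding in_rim automorphism_def by (metis bij_def injD)

lemma sum_auto:
  assumes "automorphism f"
  shows "(\<Sum>b\<in>rim. g (f b)) = (\<Sum>b\<in>rim. g b)"
proof (rule sum.reindex_bij_betw)
  have "rim = UNIV - {Hub}" unfolding set_eq_iff in_rim by simp
  moreover have "bij_betw f (UNIV - {Hub}) (f ` (UNIV - {Hub}))" "f ` (UNIV - {Hub}) = UNIV - {Hub}"
    using assms by (auto simp: automorphism_def bij_def bij_betw_def inj_on_def image_set_diff)
  ultimately show "bij_betw f rim rim" by simp
qed

text \<open>\<open>f\<close> moves rows, \<open>g\<close> columns and \<open>h\<close> labels, so
  the three coordinates can be normalised independently.\<close>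

definition act :: "(vert \<Rightarrow> vert) \<Rightarrow> (vert \<Rightarrow> vert) \<Rightarrow> (vert \<Rightarrow> vert) \<Rightarrow>
    (vert \<Rightarrow> vert \<Rightarrow> vert \<Rightarrow> bool) \<Rightarrow> vert \<Rightarrow> vert \<Rightarrow> vert \<Rightarrow> bool" where
  "act f g h S a b c = S (f a) (g b) (h c)"

lemma indep3_act: "automorphism f \<Longrightarrow> automorphism g \<Longrightarrow> automorphism h \<Longrightarrow> indep3 S \<Longrightarrow> indep3 (act f g h S)"
  unfolding indep3_def act_def automorphism_def by blast

lemma deficit_act:
  assumes "automorphism h"
  shows "deficit (act f g h S) a b = deficit S (f a) (g b)"
proof -
  have "bij_betw h {c. S (f a) (g b) (h c)} {c. S (f a) (g b) c}"
    using assms unfolding automorphism_def bij_betw_def bij_def by (auto simp: inj_on_def image_iff)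
  then show ?thesis by (simp add: deficit_def act_def bij_betw_same_card)
qed

lemma excess_act:
  assumes "automorphism g" "automorphism h"
  shows "excess (act f g h S) a = excess S (f a)"
  using sum_auto[OF assms(1), of "deficit S (f a)"] assms(1)
  by (simp add: excess_def row_deficit_def deficit_act[OF assms(2)] automorphism_def)

lemma transp_act: "transposed (act f g h S) = act g f h (transposed S)"
  by (simp add: transposed_def act_def fun_eq_iff)

definition total_excess :: "(vert \<Rightarrow> vert \<Rightarrow> vert \<Rightarrow> bool) \<Rightarrow> nat" where
  "total_excess S = (\<Sum>a\<in>rim. excess S a)"

lemma total_act:
  assumes "automorphism f" "automorphism g" "automorphism h"
  shows "total_excess (act f g h S) = total_excess S"
  unfolding total_excess_def excess_act[OF assms(2,3)] using sum_auto[OF assms(1)] .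

lemma partial_total: "partial 0 (excess S) V4 = total_excess S"
  by (simp add: total_excess_def)

lemma tight_rowE:
  assumes S: "indep3 S" and "excess S a = 0" "\<not> S a Hub Hub"
  obtains u v p q where "deficit S a Hub = 0"
    "u \<in> rim" "v \<in> rim" "u \<noteq> v" "\<not> adj u v" "deficit S a u = 0" "deficit S a v = 0"
    "p \<in> rim" "q \<in> rim" "p \<noteq> q" "\<not> adj p q" "S a Hub p" "S a Hub q"
proof -
  have full: "deficit S a Hub = 0" using tight_row[OF assms] .
  have "row_deficit S a = 3" using row_deficit_ge[OF S, of a] assms(2) by (simp add: excess_def)
  then obtain u v where "u \<in> rim" "v \<in> rim" "u \<noteq> v" "\<not> adj u v" "deficit S a u = 0" "deficit S a v = 0"
    using row_deficit_full(2)[OF S full] by blast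
  moreover obtain p q where "p \<in> rim" "q \<in> rim" "p \<noteq> q" "\<not> adj p q" "S a Hub p" "S a Hub q"
    using full_cell_pair[OF S full] .
  ultimately show ?thesis using that full by blast
qed

text \<open>A tight row provides two nonadjacent pairs: its full columns and its hub label.
  \<open>g\<close> and \<open>h\<close> bring them to \<open>V0\<close>, \<open>V2\<close>, while
  \<open>f\<close> is left to the caller, who may also have to place an adjacent row.\<close>

lemma tight_row_normal_form:
  assumes S: "indep3 S" and f: "automorphism f" and a: "f V0 = a" "excess S a = 0" "\<not> S a Hub Hub"
  obtains g h where "automorphism g" "automorphism h" "let T = act f g h S in indep3 T \<and> deficit T V0 Hub = 0 \<and>
    deficit T V0 V0 = 0 \<and> deficit T V0 V2 = 0 \<and> T V0 Hub V0 \<and> T V0 Hub V2 \<and> row_deficit T V0 \<le> 3"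
proof -
  obtain u v p q where *: "deficit S a Hub = 0"
    "u \<in> rim" "v \<in> rim" "u \<noteq> v" "\<not> adj u v" "deficit S a u = 0" "deficit S a v = 0"
    "p \<in> rim" "q \<in> rim" "p \<noteq> q" "\<not> adj p q" "S a Hub p" "S a Hub q"
    using tight_rowE[OF S a(2,3)] .
  obtain g where g: "automorphism g" "{g V0, g V2} = {u, v}" using auto_nonadjacent[OF *(2-5)] .
  obtain h where h: "automorphism h" "{h V0, h V2} = {p, q}" using auto_nonadjacent[OF *(8-11)] .
  have "deficit S a (g V0) = 0 \<and> deficit S a (g V2) = 0" "S a Hub (h V0) \<and> S a Hub (h V2)"
    using g(2) h(2) *(6,7,12,13) by (auto simp: doubleton_eq_iff)
  moreover have "excess (act f g h S) V0 = 0" using a excess_act[OF g(1) h(1)] by simp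
  moreover have "g Hub = Hub" using g(1) by (simp add: automorphism_def)
  ultimately show ?thesis
    using *(1) a(1) indep3_act[OF f g(1) h(1) S]
    by (intro that[OF g(1) h(1)]) (simp add: Let_def deficit_act[OF h(1)] excess_def, simp add: act_def)
qed

section \<open>Lower bounds for the total excess\<close>

lemma budget_3:
  assumes "x + y \<le> (3::nat)"
  shows "\<not> 4 \<le> x \<and> \<not> 4 \<le> y \<and> (\<not> 1 \<le> x \<or> \<not> 3 \<le> y) \<and> (\<not> 2 \<le> x \<or> \<not> 2 \<le> y) \<and> (\<not> 3 \<le> x \<or> \<not> 1 \<le> y)"
  using assms by linarith

lemma total_ge_5_aux:
  assumes S: "indep3 S" and noH: "\<And>a. a \<in> rim \<Longrightarrow> \<not> S a Hub Hub \<and> \<not> S Hub a Hub"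
    and le: "total_excess S \<le> 2" "total_excess S + total_excess (transposed S) \<le> 4"
  shows False
proof -
  \<comment> \<open>Five excesses with sum at most 2 cannot all be positive.\<close>
  have "\<exists>a\<in>rim. excess S a = 0"
  proof (rule ccontr)
    assume "\<not> ?thesis"
    then have "(\<Sum>a\<in>rim. 1) \<le> total_excess S" unfolding total_excess_def by (intro sum_mono) (auto simp: Suc_le_eq)
    then show False using le by simp
  qed
  then obtain a where a: "a \<in> rim" "excess S a = 0" by blast
  obtain f where f: "automorphism f" "f V0 = a" using auto_vertex[OF a(1)] .
  obtain g h where gh: "automorphism g" "automorphism h" and T: "let T = act f g h S in indep3 T \<and> deficit T V0 Hub = 0 \<and>
    deficit T V0 V0 = 0 \<and> deficit T V0 V2 = 0 \<and> T V0 Hub V0 \<and> T V0 Hub V2 \<and> row_deficit T V0 \<le> 3"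
    using tight_row_normal_form[OF S f a(2)] noH[OF a(1)] by blast
  define T where "T = act f g h S"
  have T: "indep3 T" "deficit T V0 Hub = 0" "deficit T V0 V0 = 0" "deficit T V0 V2 = 0" "T V0 Hub V0" "T V0 Hub V2"
    "row_deficit T V0 \<le> 3"
    using T unfolding T_def Let_def by simp_all
  have noHT: "\<not> T a Hub Hub \<and> \<not> T Hub a Hub" if "a \<in> rim" for a
    using noH[OF auto_rim[OF f(1) that]] noH[OF auto_rim[OF gh(1) that]] f(1) gh
    by (simp add: T_def act_def automorphism_def)
  have "total_excess T = total_excess S" "total_excess (transposed T) = total_excess (transposed S)"
    using f gh by (simp_all add: T_def transp_act total_act)
  then have budget: "\<not> 3 \<le> partial 0 (excess T) V4 \<and> \<not> 5 \<le> partial 0 (excess (transposed T)) V4 \<and>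
      (\<not> 1 \<le> partial 0 (excess T) V4 \<or> \<not> 4 \<le> partial 0 (excess (transposed T)) V4) \<and>
      (\<not> 2 \<le> partial 0 (excess T) V4 \<or> \<not> 3 \<le> partial 0 (excess (transposed T)) V4)"
    unfolding partial_total using le by linarith
  have "\<not> 4 \<le> partial (3 * deficit T V0 Hub) (deficit T V0) V4"
    using T(7) by (simp add: row_deficit_eq)
  from wheel_clauses.no_transversal_line[OF wheel_clauses_of_indep3[OF T(1)] _ _ T(2-6) this budget]
  show False using noHT by simp
qed

text \<open>If all excesses add up to at most 4, those of the rows or those of the columns add up to
  at most 2; transposing reduces the second case to the first.\<close>

lemma total_ge_5:
  assumes "indep3 S" and "\<And>a. a \<in> rim \<Longrightarrow> \<not> S a Hub Hub \<and> \<not> S Hub a Hub"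
  shows "5 \<le> total_excess S + total_excess (transposed S)"
proof (rule ccontr)
  assume "\<not> ?thesis"
  then have "total_excess S \<le> 2 \<and> total_excess S + total_excess (transposed S) \<le> 4 \<or>
    total_excess (transposed S) \<le> 2 \<and> total_excess (transposed S) + total_excess S \<le> 4" by linarith
  then show False
    using total_ge_5_aux[OF assms(1)] total_ge_5_aux[of "transposed S"] assms
    by (auto simp: indep3_transp transposed_def)
qed

lemma tight_neighbour_bound:
  assumes S: "indep3 S" and b: "b \<in> rim" "S b Hub Hub" and a: "a \<in> rim" "adj a b" "excess S a = 0"
  shows "4 \<le> total_excess S + total_excess (transposed S)"
proof (rule ccontr)
  assume le: "\<not> ?thesis"
  obtain f where f: "automorphism f" "f V0 = a" "f V1 = b" using auto_adjacent[OF a(1) b(1) a(2)] .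
  have "\<not> S a Hub Hub" using S a(2) b(2) unfolding indep3_def by blast
  then obtain g h where gh: "automorphism g" "automorphism h"
    and T: "let T = act f g h S in indep3 T \<and> deficit T V0 Hub = 0 \<and>
    deficit T V0 V0 = 0 \<and> deficit T V0 V2 = 0 \<and> T V0 Hub V0 \<and> T V0 Hub V2 \<and> row_deficit T V0 \<le> 3"
    using tight_row_normal_form[OF S f(1,2) a(3)] by blast
  define T where "T = act f g h S"
  have T: "indep3 T" "deficit T V0 Hub = 0" "deficit T V0 V0 = 0" "deficit T V0 V2 = 0" "T V0 Hub V0" "T V0 Hub V2"
    "row_deficit T V0 \<le> 3"
    using T unfolding T_def Let_def by simp_all
  have t: "T V1 Hub Hub" using b(2) f gh by (simp add: T_def act_def automorphism_def)
  have "total_excess T = total_excess S" "total_excess (transposed T) = total_excess (transposed S)"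
    using f gh by (simp_all add: T_def transp_act total_act)
  then have budget: "partial 0 (excess T) V4 + partial 0 (excess (transposed T)) V4 \<le> 3"
    unfolding partial_total using le by linarith
  have "\<not> 4 \<le> partial (3 * deficit T V0 Hub) (deficit T V0) V4"
    using T(7) by (simp add: row_deficit_eq)
  from wheel_clauses.tight_neighbour[OF wheel_clauses_of_indep3[OF T(1)] t T(2-6) this budget_3[OF budget]]
  show False .
qed

lemma loose_neighbours_bound:
  assumes S: "indep3 S" and a: "a \<in> rim" "S a Hub Hub"
    and loose: "\<And>b. b \<in> rim \<Longrightarrow> adj b a \<Longrightarrow> excess S b > 0"
  shows "4 \<le> total_excess S + total_excess (transposed S)"
proof (rule ccontr)
  assume le: "\<not> ?thesis"
  obtain f where f: "automorphism f" "f V0 = a" using auto_vertex[OF a(1)] .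
  have adj: "adj (f V1) a" "adj (f V4) a" using f unfolding automorphism_def by (metis adj_simps(5,8) insertI1 insertI2)+
  have ex: "excess S (f V1) > 0" "excess S (f V4) > 0"
    using loose adj auto_rim[OF f(1)] by simp_all
  have "total_excess S = excess S a + excess S (f V1) + excess S (f V2) + excess S (f V3) + excess S (f V4)"
    using sum_auto[OF f(1), of "excess S"] f(2) by (simp add: total_excess_def)
  \<comment> \<open>The two loose neighbours use at least 2 of the 3 available units, which leaves
    at most 1 for row \<open>a\<close>.\<close>
  then have "row_deficit S a \<le> 4"
    using ex le unfolding excess_def by linarith
  \<comment> \<open>A label containing \<open>Hub\<close> is not full, so the hub cell costs at
    least 3 of these 4 and some rim cell must be full.\<close>
  moreover have "deficit S a Hub \<noteq> 0" using full_cell(1)[OF S] a(2) by blast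
  ultimately have "(\<Sum>b\<in>rim. deficit S a b) \<le> 1" by (simp add: row_deficit_def)
  moreover have "5 \<le> (\<Sum>b\<in>rim. deficit S a b)" if "\<forall>b\<in>rim. deficit S a b \<noteq> 0"
    using sum_mono[of rim "\<lambda>_. 1" "deficit S a"] that by (simp add: Suc_le_eq)
  ultimately obtain b where b: "b \<in> rim" "deficit S a b = 0" by fastforce
  obtain g where g: "automorphism g" "g V0 = b" using auto_vertex[OF b(1)] .
  obtain p q where pq: "p \<in> rim" "q \<in> rim" "p \<noteq> q" "\<not> adj p q" "S a b p" "S a b q"
    using full_cell_pair[OF S b(2)] .
  obtain h where h: "automorphism h" "{h V0, h V2} = {p, q}" using auto_nonadjacent[OF pq(1-4)] .
  have lab: "S a b (h V0)" "S a b (h V2)" using h(2) pq(5,6) by (auto simp: doubleton_eq_iff)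
  define T where "T = act f g h S"
  have T: "indep3 T" unfolding T_def using indep3_act[OF f(1) g(1) h(1) S] .
  have t: "T V0 Hub Hub" "deficit T V0 V0 = 0" "T V0 V0 V0" "T V0 V0 V2"
    using a(2) b lab f g h by (simp_all add: T_def deficit_act) (simp_all add: act_def automorphism_def)
  have "total_excess T = total_excess S" "total_excess (transposed T) = total_excess (transposed S)"
    using f g h by (simp_all add: T_def transp_act total_act)
  then have budget: "partial 0 (excess T) V4 + partial 0 (excess (transposed T)) V4 \<le> 3"
    unfolding partial_total using le by linarith
  have "excess T V1 > 0" "excess T V4 > 0" using ex g h by (simp_all add: T_def excess_act)
  then have "4 \<le> partial (3 * deficit T V1 Hub) (deficit T V1) V4"
    "4 \<le> partial (3 * deficit T V4 Hub) (deficit T V4) V4"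
    by (simp_all add: excess_def row_deficit_eq)
  from wheel_clauses.loose_neighbours[OF wheel_clauses_of_indep3[OF T] t this budget_3[OF budget]]
  show False .
qed

text \<open>Either all rim rows adjacent to \<open>a\<close> have positive excess, or one of them is
  tight.\<close>

lemma total_ge_4:
  assumes "indep3 S" "a \<in> rim" "S a Hub Hub"
  shows "4 \<le> total_excess S + total_excess (transposed S)"
  using loose_neighbours_bound[OF assms] tight_neighbour_bound[OF assms] by (metis gr0I)

section \<open>The weight bound\<close>

text \<open>A cell is weighted by its multiplicity in the line sums, except the corner cell, which
  lies on no rim line. The total is 25*6*2 + 10*6*3 + 1 = 481.\<close>

definition weight :: "vert \<Rightarrow> vert \<Rightarrow> vert \<Rightarrow> nat" where
  "weight a b c = (if a \<noteq> Hub \<and> b \<noteq> Hub then 2 else if a \<noteq> Hub \<or> b \<noteq> Hub then 3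
     else if c = Hub then 1 else 0)"

lemma weight_bound:
  assumes S: "indep3 S"
  shows "(\<Sum>a\<in>UNIV. \<Sum>b\<in>UNIV. \<Sum>c\<in>UNIV. weight a b c * of_bool (S a b c)) \<le> 126"
proof -
  have inner: "(\<Sum>c\<in>UNIV. k * of_bool (S a b c)) + k * deficit S a b = 2 * k" for a b k
  proof -
    have "(\<Sum>c\<in>UNIV. k * of_bool (S a b c)) = k * card {c. S a b c}"
      by (simp add: sum_distrib_left[symmetric] of_bool_def sum.If_cases)
    then show ?thesis using card_cell[OF S, of a b] by (simp add: algebra_simps flip: distrib_left)
  qed
  define w where "w a b = (\<Sum>c\<in>UNIV. weight a b c * of_bool (S a b c))" for a b
  have w_rim: "w a b + 2 * deficit S a b = 4" if "a \<in> rim" "b \<in> rim" for a b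
    using inner[of 2 a b] that unfolding in_rim by (simp add: w_def weight_def)
  have w_hub: "w a Hub + 3 * deficit S a Hub = 6" "w Hub a + 3 * deficit S Hub a = 6" if "a \<in> rim" for a
    using inner[of 3 a Hub] inner[of 3 Hub a] that unfolding in_rim by (simp_all add: w_def weight_def)
  have w_HubHub: "w Hub Hub = of_bool (S Hub Hub Hub)"
    by (simp add: w_def weight_def UNIV_vert)
  \<comment> \<open>The three blocks are the rim cells, the hub column and the hub row; primes mark
    sums of deficits.\<close>
  define A where "A = (\<Sum>a\<in>rim. \<Sum>b\<in>rim. w a b)"
  define A' where "A' = (\<Sum>a\<in>rim. \<Sum>b\<in>rim. deficit S a b)"
  define B where "B = (\<Sum>a\<in>rim. w a Hub)"
  define B' where "B' = (\<Sum>a\<in>rim. deficit S a Hub)"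
  define D where "D = (\<Sum>a\<in>rim. w Hub a)"
  define D' where "D' = (\<Sum>a\<in>rim. deficit S Hub a)"
  have "A + 2 * A' = (\<Sum>a\<in>rim. \<Sum>b\<in>rim. w a b + 2 * deficit S a b)"
    unfolding A_def A'_def by (simp only: sum.distrib sum_distrib_left)
  also have "\<dots> = (\<Sum>a\<in>rim. \<Sum>b\<in>rim. 4)" using w_rim by (intro sum.cong refl) blast
  finally have A: "A + 2 * A' = 100" by simp
  have "B + 3 * B' = (\<Sum>a\<in>rim. w a Hub + 3 * deficit S a Hub)"
    unfolding B_def B'_def by (simp only: sum.distrib sum_distrib_left)
  also have "\<dots> = (\<Sum>a\<in>rim. 6)" using w_hub by (intro sum.cong refl) blast
  finally have B: "B + 3 * B' = 30" by simp
  have "D + 3 * D' = (\<Sum>a\<in>rim. w Hub a + 3 * deficit S Hub a)"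
    unfolding D_def D'_def by (simp only: sum.distrib sum_distrib_left)
  also have "\<dots> = (\<Sum>a\<in>rim. 6)" using w_hub by (intro sum.cong refl) blast
  finally have D: "D + 3 * D' = 30" by simp
  have tot: "total_excess T + 15 = (\<Sum>a\<in>rim. row_deficit T a)" if "indep3 T" for T
  proof -
    have "(\<Sum>a\<in>rim. excess T a + 3) = (\<Sum>a\<in>rim. row_deficit T a)"
      using row_deficit_ge[OF that] by (intro sum.cong refl) (simp add: excess_def)
    then show ?thesis unfolding sum.distrib by (simp add: total_excess_def)
  qed
  have r: "total_excess S + 15 = 3 * B' + A'"
    unfolding tot[OF S] B'_def A'_def row_deficit_def by (simp only: sum.distrib sum_distrib_left)
  have A'_swap: "A' = (\<Sum>b\<in>rim. \<Sum>a\<in>rim. deficit S a b)" unfolding A'_def by (rule sum.swap)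
  have "total_excess (transposed S) + 15 = (\<Sum>b\<in>rim. 3 * deficit S Hub b + (\<Sum>a\<in>rim. deficit S a b))"
    using tot[of "transposed S"] S by (simp only: indep3_transp row_deficit_def deficit_transp)
  also have "\<dots> = 3 * D' + A'"
    unfolding D'_def A'_swap by (simp only: sum.distrib sum_distrib_left)
  finally have c: "total_excess (transposed S) + 15 = 3 * D' + A'" .
  have u: "(\<Sum>b\<in>UNIV. g b) = (\<Sum>b\<in>rim. g b) + g Hub" for g :: "vert \<Rightarrow> nat"
    by (simp add: UNIV_vert)
  have "(\<Sum>a\<in>UNIV. \<Sum>b\<in>UNIV. w a b) = A + B + D + of_bool (S Hub Hub Hub)"
    unfolding u A_def B_def D_def w_HubHub by (simp only: sum.distrib)
  \<comment> \<open>The blocks give weight 160 - 2 \<open>A'\<close> - 3 \<open>B'\<close> - 3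
    \<open>D'\<close>, that is 130 minus the total excess, plus the corner element. One more unit of
    excess pays for that element.\<close>
  moreover have "4 + of_bool (S Hub Hub Hub) \<le> total_excess S + total_excess (transposed S)"
  proof (cases "\<exists>a\<in>rim. S a Hub Hub \<or> S Hub a Hub")
    case True
    then obtain a where a: "a \<in> rim" "S a Hub Hub \<or> S Hub a Hub" by blast
    \<comment> \<open>The corner element is adjacent to \<open>(a, Hub, Hub)\<close> and to
      \<open>(Hub, a, Hub)\<close>.\<close>
    then have "\<not> S Hub Hub Hub" using S unfolding indep3_def in_rim by (metis adj_simps(1))
    moreover have "4 \<le> total_excess S + total_excess (transposed S)"
      using a total_ge_4[OF S a(1)] total_ge_4[of "transposed S" a] S
      by (auto simp: indep3_transp transposed_def)
    ultimately show ?thesis by simp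
  next
    case False
    then have "5 \<le> total_excess S + total_excess (transposed S)" using total_ge_5[OF S] by blast
    then show ?thesis by simp
  qed
  ultimately show ?thesis unfolding w_def[symmetric] using A B D r c by linarith
qed

section \<open>Weighted independent sets and the ultimate independence ratio\<close>

lemma parcs_append_left:
  assumes "(xs, ys) \<in> parcs (cart_power G a)" "zs \<in> pverts (cart_power G b)"
  shows "(xs @ zs, ys @ zs) \<in> parcs (cart_power G (a + b))"
  using assms(2)
proof (induction b arbitrary: zs)
  case 0
  then show ?case using assms(1) by simp
next
  case (Suc b)
  obtain ws z where zs: "zs = ws @ [z]" "ws \<in> pverts (cart_power G b)" "z \<in> pverts G"
    using Suc.prems unfolding pverts_cart_power by (cases zs rule: rev_cases) auto
  then show ?case
    using Suc.IH[OF zs(2)] parcs_cart_power_Suc[of "xs @ ws" z "ys @ ws" z G "a + b"]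
    by (simp del: cart_power_Suc)
qed

lemma parcs_append_right:
  assumes "(xs, ys) \<in> parcs (cart_power G b)" "zs \<in> pverts (cart_power G a)"
  shows "(zs @ xs, zs @ ys) \<in> parcs (cart_power G (a + b))"
  using assms(1)
proof (induction b arbitrary: xs ys)
  case 0
  then show ?case by simp
next
  case (Suc b)
  have "\<exists>vs v. ws = vs @ [v]" if "ws = xs \<or> ws = ys" for ws
    using Suc.prems that by (auto simp: rename_verts_def)
  then obtain us u vs v where uv: "xs = us @ [u]" "ys = vs @ [v]" by metis
  have "us = vs \<and> us \<in> pverts (cart_power G b) \<and> (u, v) \<in> parcs G \<or>
     u = v \<and> u \<in> pverts G \<and> (us, vs) \<in> parcs (cart_power G b)"
    using Suc.prems unfolding uv parcs_cart_power_Suc .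
  moreover have "zs @ us \<in> pverts (cart_power G (a + b))" if "us \<in> pverts (cart_power G b)"
    using assms(2) that by (simp add: pverts_cart_power)
  ultimately show ?case
    using Suc.IH parcs_cart_power_Suc[of "zs @ us" u "zs @ vs" v G "a + b"]
    by (auto simp: uv simp del: cart_power_Suc)
qed

lemma sum_pverts_cart_power_add:
  "(\<Sum>xs\<in>pverts (cart_power G (a + b)). g xs) =
     (\<Sum>z\<in>pverts (cart_power G a). \<Sum>y\<in>pverts (cart_power G b). g (z @ y))"
proof -
  have "bij_betw (\<lambda>(z, y). z @ y) (pverts (cart_power G a) \<times> pverts (cart_power G b))
      (pverts (cart_power G (a + b)))"
  proof (rule bij_betwI[where g = "\<lambda>xs. (take a xs, drop a xs)"])
    show "(\<lambda>xs. (take a xs, drop a xs)) \<in> pverts (cart_power G (a + b)) \<rightarrow>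
        pverts (cart_power G a) \<times> pverts (cart_power G b)"
      by (auto simp: pverts_cart_power dest: in_set_takeD in_set_dropD)
  qed (auto simp: pverts_cart_power)
  from sum.reindex_bij_betw[OF this, of g, symmetric] show ?thesis
    by (simp add: sum.cartesian_product case_prod_beta)
qed

section \<open>First and second moments of block sums\<close>

primrec block_sum :: "('a list \<Rightarrow> real) \<Rightarrow> nat \<Rightarrow> nat \<Rightarrow> 'a list \<Rightarrow> real" where
  "block_sum u r 0 xs = 0"
| "block_sum u r (Suc k) xs = u (take r xs) + block_sum u r k (drop r xs)"

lemma block_sum_append:
  "z \<in> pverts (cart_power G r) \<Longrightarrow> block_sum u r (Suc k) (z @ y) = u z + block_sum u r k y"
  by (simp add: pverts_cart_power)

lemma block_sum_diff: "block_sum (\<lambda>z. u z - c) r k xs = block_sum u r k xs - k * c"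
  by (induction k arbitrary: xs) (auto simp: algebra_simps)

context
  fixes G :: "'a pair_pre_digraph" and u :: "'a list \<Rightarrow> real" and r :: nat
  assumes fin: "finite (pverts G)"
begin

lemma finite_power: "finite (pverts (cart_power G m))" and card_power: "card (pverts (cart_power G m)) = card (pverts G) ^ m"
  using fin by (simp_all add: finite_pverts_cart_power card_pverts_cart_power)

text \<open>Induction on the blocks: fixing the tail bounds the first block by \<open>B\<close>,
  fixing the head leaves an independent set for the other blocks. The factor on the left avoids the
  exponent \<open>r * (k - 1)\<close>.\<close>

lemma sum_block_sum_indep:
  assumes B: "\<And>S. independent_verts (cart_power G r) S \<Longrightarrow> sum u S \<le> B"
    and S: "independent_verts (cart_power G (r * k)) S"
  shows "real (card (pverts G)) ^ r * sum (block_sum u r k) S \<le> k * B * real (card (pverts G)) ^ (r * k)"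
  using S
proof (induction k arbitrary: S)
  case 0
  then show ?case by simp
next
  case (Suc k)
  have sub: "S \<subseteq> pverts (cart_power G (r + r * k))" and
    nadj: "\<And>xs ys. xs \<in> S \<Longrightarrow> ys \<in> S \<Longrightarrow> (xs, ys) \<notin> parcs (cart_power G (r + r * k))"
    using Suc.prems by (auto simp: independent_verts_def)
  define L where "L y = {z \<in> pverts (cart_power G r). z @ y \<in> S}" for y
  define M where "M z = {y \<in> pverts (cart_power G (r * k)). z @ y \<in> S}" for z
  have L: "sum u (L y) \<le> B" if "y \<in> pverts (cart_power G (r * k))" for y
  proof (rule B)
    show "independent_verts (cart_power G r) (L y)"
      unfolding independent_verts_def L_def using parcs_append_left[OF _ that, of _ _ r] nadj by blast
  qed
  have M: "real (card (pverts G)) ^ r * sum (block_sum u r k) (M z) \<le> k * B * real (card (pverts G)) ^ (r * k)" if "z \<in> pverts (cart_power G r)" for z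
  proof (rule Suc.IH)
    show "independent_verts (cart_power G (r * k)) (M z)"
      unfolding independent_verts_def M_def using parcs_append_right[OF _ that, of _ _ "r * k"] nadj by blast
  qed
  \<comment> \<open>As an indicator sum over all vertices, the sum over \<open>S\<close> splits
    along head and tail and can be reordered.\<close>
  have "sum (block_sum u r (Suc k)) S =
      (\<Sum>xs\<in>pverts (cart_power G (r + r * k)). if xs \<in> S then block_sum u r (Suc k) xs else 0)"
    using sub by (simp add: sum.If_cases[OF finite_power] Int_absorb1)
  also have "\<dots> = (\<Sum>z\<in>pverts (cart_power G r). \<Sum>y\<in>pverts (cart_power G (r * k)).
      (if z @ y \<in> S then u z else 0) + (if z @ y \<in> S then block_sum u r k y else 0))"
    unfolding sum_pverts_cart_power_add
    by (intro sum.cong refl) (simp add: block_sum_append del: block_sum.simps)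
  also have "\<dots> = (\<Sum>y\<in>pverts (cart_power G (r * k)). sum u (L y)) + (\<Sum>z\<in>pverts (cart_power G r). sum (block_sum u r k) (M z))"
    unfolding sum.distrib
    by (subst sum.swap) (simp add: L_def M_def sum.inter_filter[OF finite_power])
  finally have eq: "sum (block_sum u r (Suc k)) S = \<dots>" .
  have "(\<Sum>y\<in>pverts (cart_power G (r * k)). sum u (L y)) \<le> real (card (pverts G)) ^ (r * k) * B"
    using sum_bounded_above[of "pverts (cart_power G (r * k))" "\<lambda>y. sum u (L y)" B] L by (simp add: card_power)
  moreover have "(\<Sum>z\<in>pverts (cart_power G r). real (card (pverts G)) ^ r * sum (block_sum u r k) (M z)) \<le>
      real (card (pverts G)) ^ r * (k * B * real (card (pverts G)) ^ (r * k))"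
    using sum_bounded_above[of "pverts (cart_power G r)" "\<lambda>z. real (card (pverts G)) ^ r * sum (block_sum u r k) (M z)"] M
    by (simp add: card_power)
  moreover have "real (card (pverts G)) ^ r * sum (block_sum u r (Suc k)) S = real (card (pverts G)) ^ r * (\<Sum>y\<in>pverts (cart_power G (r * k)). sum u (L y))
      + (\<Sum>z\<in>pverts (cart_power G r). real (card (pverts G)) ^ r * sum (block_sum u r k) (M z))"
    unfolding eq distrib_left by (simp only: sum_distrib_left)
  ultimately have "real (card (pverts G)) ^ r * sum (block_sum u r (Suc k)) S \<le>
      real (card (pverts G)) ^ r * (real (card (pverts G)) ^ (r * k) * B) + real (card (pverts G)) ^ r * (k * B * real (card (pverts G)) ^ (r * k))"
    by (simp only: add_mono mult_left_mono zero_le_power of_nat_0_le_iff)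
  then show ?case by (simp add: algebra_simps power_add)
qed

lemma sum_block_sum:
  assumes "sum u (pverts (cart_power G r)) = 0"
  shows "sum (block_sum u r k) (pverts (cart_power G (r * k))) = 0"
proof (induction k)
  case (Suc k)
  have "sum (block_sum u r (Suc k)) (pverts (cart_power G (r * Suc k))) =
    (\<Sum>z\<in>pverts (cart_power G r). \<Sum>y\<in>pverts (cart_power G (r * k)). u z + block_sum u r k y)"
    unfolding mult_Suc_right sum_pverts_cart_power_add
    by (intro sum.cong refl) (simp add: block_sum_append del: block_sum.simps)
  then show ?case using Suc assms by (simp add: sum.distrib flip: sum_distrib_left)
qed simp

text \<open>This is the variance of a sum of independent centred variables: the cross terms vanish
  by \<open>sum_block_sum\<close>.\<close>

lemma sum_block_sum_square:
  assumes "sum u (pverts (cart_power G r)) = 0"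
  shows "real (card (pverts G)) ^ r * (\<Sum>xs\<in>pverts (cart_power G (r * k)). (block_sum u r k xs)\<^sup>2) =
    k * (\<Sum>z\<in>pverts (cart_power G r). (u z)\<^sup>2) * real (card (pverts G)) ^ (r * k)"
proof (induction k)
  case (Suc k)
  define Q where "Q = (\<Sum>xs\<in>pverts (cart_power G (r * k)). (block_sum u r k xs)\<^sup>2)"
  have "(\<Sum>xs\<in>pverts (cart_power G (r * Suc k)). (block_sum u r (Suc k) xs)\<^sup>2) =
    (\<Sum>z\<in>pverts (cart_power G r). \<Sum>y\<in>pverts (cart_power G (r * k)). (u z)\<^sup>2 + 2 * u z * block_sum u r k y + (block_sum u r k y)\<^sup>2)"
    unfolding mult_Suc_right sum_pverts_cart_power_add
    by (intro sum.cong refl) (simp add: block_sum_append power2_sum del: block_sum.simps)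
  also have "\<dots> = real (card (pverts G)) ^ (r * k) * (\<Sum>z\<in>pverts (cart_power G r). (u z)\<^sup>2) + real (card (pverts G)) ^ r * Q"
    using sum_block_sum[OF assms]
    by (simp add: sum.distrib card_power Q_def flip: sum_distrib_left)
  finally show ?case using Suc unfolding Q_def[symmetric]
    by (simp add: algebra_simps power_add)
qed simp

end

section \<open>From the second moment to the limit\<close>

lemma abs_le_square: "\<bar>x\<bar> \<le> e + x\<^sup>2 / e" if "e > 0" for x e :: real
proof (cases "\<bar>x\<bar> \<le> e")
  case False
  then have "\<bar>x\<bar> * e \<le> \<bar>x\<bar> * \<bar>x\<bar>" by (intro mult_left_mono) auto
  then have "\<bar>x\<bar> \<le> x\<^sup>2 / e" using that by (simp add: pos_le_divide_eq power2_eq_square)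
  then show ?thesis using that by simp
qed (use that in \<open>simp add: add_increasing2\<close>)

lemma ultimate_independence_ratio_le_weighted:
  fixes G :: "'a pair_pre_digraph"
  assumes fin: "finite (pverts G)" and r: "r > 0"
    and B: "\<And>S. independent_verts (cart_power G r) S \<Longrightarrow> sum u S \<le> B"
    and pos: "sum u (pverts (cart_power G r)) > 0"
  shows "ultimate_independence_ratio G \<le> B / sum u (pverts (cart_power G r))"
proof -
  let ?P = "cart_power G" and ?n = "real (card (pverts G))"
  define U where "U = sum u (pverts (?P r))"
  \<comment> \<open>\<open>m\<close> is the mean of \<open>u\<close> over the vertices of the power
    \<open>r\<close>, and \<open>v\<close> is \<open>u\<close> centred.\<close>
  define m where "m = U / ?n ^ r"
  define v where "v z = u z - m" for z
  define s where "s = (\<Sum>z\<in>pverts (?P r). (v z)\<^sup>2)"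
  have "pverts (?P r) = {}" if "pverts G = {}"
    using r that by (auto simp: pverts_cart_power)
  then have "pverts G \<noteq> {}" using pos by auto
  then have n: "?n > 0" using fin by (simp add: card_gt_0_iff)
  have U: "U > 0" using pos by (simp add: U_def)
  have m: "m > 0" using U n by (simp add: m_def)
  have v0: "sum v (pverts (?P r)) = 0"
    using n by (simp add: v_def sum_subtractf card_power[OF fin] m_def U_def)
  have bound: "independence_ratio (?P (r * k)) \<le> B / U + (1 + s / ?n ^ r) / m * (1 / sqrt k)" if k: "k > 0" for k
  proof -
    obtain S where S: "independent_verts (?P (r * k)) S" "card S = independence_number (?P (r * k))"
      using independence_number_attained[OF finite_power[OF fin]] .
    have sub: "S \<subseteq> pverts (?P (r * k))" using S(1) by (simp add: independent_verts_def)
    let ?N = "?n ^ (r * k)" and ?R = "?n ^ r"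
    have N: "?N > 0" "?R > 0" using n by simp_all
    \<comment> \<open>Deviations of order \<open>sqrt k\<close> balance the two terms of \<open>abs_le_square\<close>.\<close>
    define e where "e = sqrt k"
    have e: "e > 0" "e * e = k" using k by (simp_all add: e_def)
    have "- sum (block_sum v r k) S \<le> (\<Sum>xs\<in>S. \<bar>block_sum v r k xs\<bar>)"
      using sum_abs[of "block_sum v r k" S] by linarith
    \<comment> \<open>Nothing is known about where \<open>S\<close> lies, so the deviation is summed
      over all vertices.\<close>
    also have "\<dots> \<le> (\<Sum>xs\<in>pverts (?P (r * k)). \<bar>block_sum v r k xs\<bar>)"
      by (intro sum_mono2 finite_power fin sub) auto
    also have "\<dots> \<le> (\<Sum>xs\<in>pverts (?P (r * k)). e + (block_sum v r k xs)\<^sup>2 / e)"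
      by (intro sum_mono abs_le_square e)
    also have "\<dots> = ?N * e + (\<Sum>xs\<in>pverts (?P (r * k)). (block_sum v r k xs)\<^sup>2) / e"
      by (simp add: sum.distrib card_power[OF fin] sum_divide_distrib)
    also have "(\<Sum>xs\<in>pverts (?P (r * k)). (block_sum v r k xs)\<^sup>2) = k * s * ?N / ?R"
      using sum_block_sum_square[OF fin v0, of k] N by (simp add: s_def field_simps)
    also have "?N * e + k * s * ?N / ?R / e = ?N * e * (1 + s / ?R)"
      using e N by (simp add: field_simps flip: e(2))
    finally have 1: "- sum (block_sum v r k) S \<le> ?N * e * (1 + s / ?R)" .
    have 2: "sum (block_sum u r k) S \<le> k * B * ?N / ?R"
      using sum_block_sum_indep[OF fin B S(1)] N by (simp add: field_simps)
    \<comment> \<open>Centring shifts each block sum by \<open>k * m\<close>; this is where the size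
      of \<open>S\<close> enters.\<close>
    have "sum (block_sum v r k) S = sum (block_sum u r k) S - card S * (k * m)"
      unfolding v_def[abs_def] block_sum_diff by (simp add: sum_subtractf)
    with 1 2 have "card S * (k * m) \<le> ?N * (k * B / ?R + e * (1 + s / ?R))"
      by (simp add: algebra_simps)
    then have "card S / ?N \<le> (k * B / ?R + e * (1 + s / ?R)) / (k * m)"
      using m k unfolding pos_divide_le_eq[OF N(1)] times_divide_eq_left
      by (subst pos_le_divide_eq) (simp_all add: mult.commute)
    also have "\<dots> = B / U + (1 + s / ?R) / m * (1 / e)"
    proof -
      have "k * B / ?R / (k * m) = B / U" using k N U by (simp add: m_def)
      moreover have "e * (1 + s / ?R) / (k * m) = (1 + s / ?R) / m * (1 / e)"
        using e m unfolding e(2)[symmetric] by simp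
      ultimately show ?thesis by (simp only: add_divide_distrib)
    qed
    finally show ?thesis
      using S(2) by (simp add: independence_ratio_def card_power[OF fin] e_def)
  qed
  have "(\<lambda>j. independence_ratio (?P j)) \<longlonglongrightarrow> ultimate_independence_ratio G"
    using convergent_independence_ratio[OF fin] by (simp add: ultimate_independence_ratio_def convergent_LIMSEQ_iff)
  \<comment> \<open>The whole sequence converges, so the multiples of \<open>r\<close> determine its
    limit.\<close>
  then have "(\<lambda>k. independence_ratio (?P (r * k))) \<longlonglongrightarrow> ultimate_independence_ratio G"
    using LIMSEQ_subseq_LIMSEQ[of _ _ "\<lambda>k. r * k"] r by (simp add: strict_mono_def o_def)
  moreover have "(\<lambda>k. B / U + (1 + s / ?n ^ r) / m * (1 / sqrt (real k))) \<longlonglongrightarrow> B / U + (1 + s / ?n ^ r) / m * 0"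
    by (intro tendsto_intros tendsto_divide_0[OF tendsto_const] filterlim_at_top_imp_at_infinity
        filterlim_compose[OF sqrt_at_top] filterlim_real_sequentially)
  ultimately have "ultimate_independence_ratio G \<le> B / U + (1 + s / ?n ^ r) / m * 0"
    using bound by (intro LIMSEQ_le) (auto intro!: exI[of _ 1])
  then show ?thesis by (simp add: U_def)
qed

section \<open>The cube of the wheel as a graph\<close>

fun emb :: "vert \<Rightarrow> nat + unit" where
  "emb V0 = Inl 0" | "emb V1 = Inl 1" | "emb V2 = Inl 2" | "emb V3 = Inl 3" | "emb V4 = Inl 4" | "emb Hub = Inr ()"

lemma inj_emb: "inj emb"
proof (rule injI)
  show "emb u = emb v \<Longrightarrow> u = v" for u v by (cases u; cases v; simp)
qed

lemma pverts_wheel_5: "pverts (wheel 5) = range emb"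
proof -
  have "{..<5::nat} = {0, 1, 2, 3, 4}" by auto
  then show ?thesis
    by (auto simp: UNIV_vert wheel_def graph_join_def cycle_graph_def single_vertex_def)
qed

lemma parcs_wheel_5: "adj u v \<Longrightarrow> (emb u, emb v) \<in> parcs (wheel 5)"
proof -
  have *: "(Inl i, Inl j) \<in> map_prod Inl Inl ` A \<longleftrightarrow> (i, j) \<in> A" for i j :: nat and A
    by auto
  show "adj u v \<Longrightarrow> ?thesis"
    by (cases u; cases v; simp add: wheel_def graph_join_def cycle_graph_def single_vertex_def *)
qed

lemma parcs_cube:
  assumes "adj u v"
  shows "([emb a, emb b, emb u], [emb a, emb b, emb v]) \<in> parcs (cart_power (wheel 5) 3)"
    and "([emb a, emb u, emb b], [emb a, emb v, emb b]) \<in> parcs (cart_power (wheel 5) 3)"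
    and "([emb u, emb a, emb b], [emb v, emb a, emb b]) \<in> parcs (cart_power (wheel 5) 3)"
proof -
  let ?P = "cart_power (wheel 5)"
  have e: "([emb u], [emb v]) \<in> parcs (?P 1)"
    using parcs_cart_power_Suc[of "[]" "emb u" "[]" "emb v" "wheel 5" 0] parcs_wheel_5[OF assms] by simp
  have v: "[emb a] \<in> pverts (?P 1)" "[emb a, emb b] \<in> pverts (?P 2)" "[emb b] \<in> pverts (?P 1)" for a b
    unfolding pverts_cart_power pverts_wheel_5 by auto
  show "([emb a, emb b, emb u], [emb a, emb b, emb v]) \<in> parcs (?P 3)"
    using parcs_append_right[OF e v(2)[of a b]] by (simp del: cart_power_Suc)
  show "([emb u, emb a, emb b], [emb v, emb a, emb b]) \<in> parcs (?P 3)"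
    using parcs_append_left[OF e v(2)[of a b]] by (simp add: numeral_3_eq_3 del: cart_power_Suc)
  show "([emb a, emb u, emb b], [emb a, emb v, emb b]) \<in> parcs (?P 3)"
    \<comment> \<open>For the middle coordinate, \<open>a\<close> is put on the left first and
      \<open>b\<close> on the right afterwards.\<close>
    using parcs_append_left[OF parcs_append_right[OF e v(1)[of a]] v(3)[of b]]
    by (simp add: numeral_3_eq_3 del: cart_power_Suc)
qed

lemma sum_cube:
  "(\<Sum>xs\<in>pverts (cart_power (wheel 5) 3). g xs) =
     (\<Sum>a\<in>UNIV. \<Sum>b\<in>UNIV. \<Sum>c\<in>UNIV. g [emb a, emb b, emb c])"
proof -
  have "bij_betw (\<lambda>(a, b, c). [emb a, emb b, emb c]) (UNIV \<times> UNIV \<times> UNIV) (pverts (cart_power (wheel 5) 3))"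
    using inj_emb unfolding pverts_cart_power pverts_wheel_5
    by (auto simp: bij_betw_def inj_on_def numeral_3_eq_3 length_Suc_conv image_iff)
  from sum.reindex_bij_betw[OF this, of g, symmetric] show ?thesis
    by (simp add: sum.cartesian_product case_prod_beta)
qed

theorem theorem1p7:
  shows "ultimate_independence_ratio (wheel 5) \<le> 1019 / 3888"
proof -
  define u where "u xs = real (weight (inv emb (xs ! 0)) (inv emb (xs ! 1)) (inv emb (xs ! 2)))" for xs
  have u: "u [emb a, emb b, emb c] = weight a b c" for a b c
    by (simp add: u_def inv_f_f[OF inj_emb])
  have fin: "finite (pverts (wheel 5))" by (simp add: pverts_wheel_5)
  have "sum u S \<le> 126" if S: "independent_verts (cart_power (wheel 5) 3) S" for S
  proof -
    define T where "T a b c \<longleftrightarrow> [emb a, emb b, emb c] \<in> S" for a b c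
    have "indep3 T"
      using S parcs_cube unfolding indep3_def independent_verts_def T_def by blast
    have "sum u S = (\<Sum>xs\<in>pverts (cart_power (wheel 5) 3). if xs \<in> S then u xs else 0)"
      using S finite_power[OF fin, of 3] by (simp add: sum.If_cases Int_absorb1 independent_verts_def)
    also have "\<dots> = (\<Sum>a\<in>UNIV. \<Sum>b\<in>UNIV. \<Sum>c\<in>UNIV. real (weight a b c * of_bool (T a b c)))"
      unfolding sum_cube by (intro sum.cong refl) (simp add: u T_def)
    also have "\<dots> = real (\<Sum>a\<in>UNIV. \<Sum>b\<in>UNIV. \<Sum>c\<in>UNIV. weight a b c * of_bool (T a b c))"
      by (simp only: of_nat_sum)
    also have "\<dots> \<le> 126" using weight_bound[OF \<open>indep3 T\<close>] by linarith
    finally show ?thesis .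
  qed
  moreover have "sum u (pverts (cart_power (wheel 5) 3)) = 481"
    unfolding sum_cube u by (simp add: UNIV_vert weight_def)
  ultimately have "ultimate_independence_ratio (wheel 5) \<le> 126 / 481"
    using ultimate_independence_ratio_le_weighted[OF fin, of 3 u 126] by simp
  \<comment> \<open>The bound obtained is slightly stronger: 126 * 3888 = 489888 < 490139 = 1019 *
    481.\<close>
  then show ?thesis by simp
qed

end
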